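(* Let $n\ge 1$ and let $f,g\in C_0(\mathbb{R}^n)$. Then $$\|f\star_0 g\|_1\le 2^n\,\|f\star_0\bar g\|_1 .$$ Moreover, the constant is sharp, i.e. for each $n$ the constant $2^n$ cannot be replaced by a smaller one in this inequality (for all $f,g\in C_0(\mathbb{R}^n)$).
   Context: $C_0(\mathbb{R}^n)$ is the set of upper semicontinuous log-concave functions $f:\mathbb{R}^n\to[0,\infty)$ (i.e. $f(\lambda x+(1-\lambda)y)\ge f(x)^\lambda f(y)^{1-\lambda}$ for all $x,y$ with $f(x),f(y)>0$ and $\lambda\in[0,1]$) with $\|f\|_\infty=f(0)=1$ and $\lim_{|x|\to\infty}f(x)=0$. The Asplund product is $(f\star_0 g)(x)=\sup_{y+z=x}f(y)g(z)$. $\bar g(x)=g(-x)$. $\|f\|_1=\int_{\mathbb{R}^n}f(x)\,dx$ for $f\ge0$. *)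

theory Defs
  imports "HOL-Analysis.Analysis"
begin

definition upper_semicont :: "('a::topological_space \<Rightarrow> real) \<Rightarrow> bool" where
  "upper_semicont f \<longleftrightarrow> (\<forall>x. \<forall>c > f x. \<forall>\<^sub>F y in nhds x. f y < c)"

definition log_concave_fun :: "('a::real_vector \<Rightarrow> real) \<Rightarrow> bool" where
  "log_concave_fun f \<longleftrightarrow>
     (\<forall>x y. \<forall>l\<in>{0..1}. f x > 0 \<longrightarrow> f y > 0 \<longrightarrow>
        f (l *\<^sub>R x + (1 - l) *\<^sub>R y) \<ge> f x powr l * f y powr (1 - l))"

(* Extended-real valued, so that equating it to a real number entails boundedness. *)
definition sup_norm :: "('a \<Rightarrow> real) \<Rightarrow> ereal" where
  "sup_norm f = (SUP x. ereal \<bar>f x\<bar>)"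

definition C0 :: "('a::real_normed_vector \<Rightarrow> real) set" where
  "C0 = {f. (\<forall>x. f x \<ge> 0) \<and> upper_semicont f \<and> log_concave_fun f \<and>
            sup_norm f = ereal (f 0) \<and> f 0 = 1 \<and> (f \<longlongrightarrow> 0) at_infinity}"

(* The real supremum ranges over a nonempty set that is bounded (by 1) whenever f and g are
   in C0; for unbounded families its value is unspecified. *)
definition asplund :: "('a::real_vector \<Rightarrow> real) \<Rightarrow> ('a \<Rightarrow> real) \<Rightarrow> 'a \<Rightarrow> real"
    (infixl "\<star>\<^sub>0" 70) where
  "(f \<star>\<^sub>0 g) x = (SUP (y, z)\<in>{(y, z). y + z = x}. f y * g z)"

definition reflect :: "('a::uminus \<Rightarrow> real) \<Rightarrow> 'a \<Rightarrow> real" where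
  "reflect g x = g (- x)"

(* Valued in [0, \<infinity>], hence meaningful without an integrability side condition. *)
definition L1_norm :: "('a::euclidean_space \<Rightarrow> real) \<Rightarrow> ennreal" where
  "L1_norm f = (\<integral>\<^sup>+ x. ennreal \<bar>f x\<bar> \<partial>lborel)"

end

theory Submission
  imports Defs
begin

text \<open>
  The inequality is a Rogers--Shephard estimate that follows from a functional form of Ruzsa's
  triangle inequality. For convex bodies the idea is short: for \<open>x = k + l\<close> with \<open>k\<close> in \<open>K\<close> and
  \<open>l\<close> in \<open>L\<close>, and for \<open>w\<close> in \<open>C\<close>, the point \<open>k + w\<close> lies in \<open>K + C\<close> and \<open>l - w\<close> in \<open>L - C\<close>, and
  these two points sum to \<open>x\<close>. Measuring all pairs gives \<open>|K + L| |C| \<le> |K + C| |L - C|\<close>, and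
  \<open>C = -L\<close> turns the right-hand side into \<open>|K - L| |2 L|\<close>, which is \<open>2\<^sup>n |K - L| |C|\<close>.

  For functions the same argument (\<open>asplund_ruzsa_triangle\<close>) produces the weight
  \<open>\<integral> p\<^sup>2\<close> in place of \<open>|C|\<close>. With \<open>p\<close> the reflection of \<open>g\<close>, log-concavity gives
  \<open>p(y) p(z) \<le> p((y + z) / 2)\<^sup>2\<close>, whose integral over \<open>y + z\<close> is \<open>2\<^sup>n \<integral> p\<^sup>2\<close>, and the weight
  cancels. The weight may vanish, namely when \<open>g\<close> lives on a proper subspace. So \<open>p\<close> is thickened
  first: it is replaced by its Asplund product with \<open>h(\<cdot> / e)\<close>, where \<open>h\<close> is the product of \<open>f\<close>
  with the reflection of \<open>g\<close>. This costs only a dilation of \<open>h\<close> by the factor \<open>1 + e\<close>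
  (\<open>L1_norm_asplund_reflect_le_dilated\<close>), so no limit of integrals has to be taken: at the end
  \<open>e\<close> tends to \<open>0\<close> in a numerical factor. If \<open>h\<close> itself vanishes almost everywhere, then all
  functions involved are supported in one proper subspace (\<open>L1_norm_asplund_null\<close>).

  Measurability, and the possibility to work with maximisers instead of suprema, come from the fact
  that the class is closed under the Asplund product (\<open>C0_asplund\<close>).

  The constant is attained by the exponential \<open>exp (- (x\<^sub>1 + \<dots> + x\<^sub>n))\<close> on the positive orthant,
  paired with its reflection: their product is \<open>exp (- (|x\<^sub>1| + \<dots> + |x\<^sub>n|))\<close>, of integral \<open>2\<^sup>n\<close>, whereas
  the product of the exponential with itself is itself, of integral \<open>1\<close>.
\<close>

section \<open>Upper semicontinuous functions\<close>

lemma closed_superlevel_upper_semicont: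
  assumes "upper_semicont f"
  shows "closed {x. c \<le> f x}"
proof -
  have "open (- {x. c \<le> f x})"
    using assms unfolding upper_semicont_def
    by (subst open_subopen) (auto simp: eventually_nhds subset_eq not_le)
  then show ?thesis by (simp add: closed_def)
qed

lemma upper_semicontI_closed_superlevel:
  assumes "\<And>c. closed {x. c \<le> f x}"
  shows "upper_semicont f"
  unfolding upper_semicont_def
proof (intro allI impI)
  fix x c assume "f x < c"
  then have "open (- {x. c \<le> f x})" "x \<in> - {x. c \<le> f x}" using assms by auto
  then show "\<forall>\<^sub>F y in nhds x. f y < c"
    unfolding eventually_nhds by (intro exI[of _ "- {x. c \<le> f x}"]) auto
qed

lemma borel_measurable_upper_semicont:
  fixes f :: "'a::topological_space \<Rightarrow> real"
  assumes "upper_semicont f"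
  shows "f \<in> borel_measurable borel"
  by (rule borel_measurableI_ge) (simp add: closed_superlevel_upper_semicont[OF assms] borel_closed)

lemma upper_semicont_compose:
  assumes "upper_semicont f" "continuous_on UNIV m"
  shows "upper_semicont (\<lambda>x. f (m x))"
proof (rule upper_semicontI_closed_superlevel)
  fix c
  have "closed (m -` {x. c \<le> f x})"
    by (rule closed_vimage[OF closed_superlevel_upper_semicont[OF assms(1)] assms(2)])
  then show "closed {x. c \<le> f (m x)}" by (simp add: vimage_def)
qed

lemma upper_semicont_mult:
  fixes f g :: "'a::topological_space \<Rightarrow> real"
  assumes f: "upper_semicont f" "\<And>x. 0 \<le> f x" and g: "upper_semicont g" "\<And>x. 0 \<le> g x"
  shows "upper_semicont (\<lambda>x. f x * g x)"
  unfolding upper_semicont_def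
proof (intro allI impI)
  fix x c assume c: "f x * g x < c"
  have "((\<lambda>e. (f x + e) * (g x + e)) \<longlongrightarrow> (f x + 0) * (g x + 0)) (at_right 0)"
    by (intro tendsto_intros)
  then have "\<forall>\<^sub>F e in at_right 0. (f x + e) * (g x + e) < c"
    using c by (simp add: order_tendsto_iff)
  then have "\<forall>\<^sub>F e in at_right (0::real). (f x + e) * (g x + e) < c \<and> 0 < e"
    using eventually_at_right_less by (rule eventually_conj)
  then obtain e where e: "(f x + e) * (g x + e) < c" "0 < e"
    using eventually_happens trivial_limit_at_right_real by blast
  \<comment> \<open>The slack \<open>e\<close> is needed because \<open>f x\<close> or \<open>g x\<close> may be zero.\<close>
  have "\<forall>\<^sub>F y in nhds x. f y < f x + e" "\<forall>\<^sub>F y in nhds x. g y < g x + e"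
    using f(1) g(1) e(2) unfolding upper_semicont_def by auto
  then show "\<forall>\<^sub>F y in nhds x. f y * g y < c"
  proof eventually_elim
    case (elim y)
    then have "f y * g y \<le> (f x + e) * (g x + e)"
      using f(2)[of x] f(2)[of y] g(2)[of y] e(2) by (intro mult_mono) auto
    then show ?case using e(1) by simp
  qed
qed

lemma upper_semicont_attains_sup:
  fixes p :: "'a::topological_space \<Rightarrow> real"
  assumes p: "upper_semicont p" and S: "compact S" "S \<noteq> {}"
  shows "\<exists>y\<in>S. \<forall>z\<in>S. p z \<le> p y"
proof (rule ccontr)
  assume "\<not> ?thesis"
  then have cover: "S \<subseteq> (\<Union>z\<in>S. - {y. p z \<le> p y})"
    by (auto simp: not_le)
  \<comment> \<open>A maximum of \<open>p\<close> over the finite subcover would have to be exceeded within that subcover.\<close>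
  obtain D where D: "D \<subseteq> S" "finite D" "S \<subseteq> (\<Union>z\<in>D. - {y. p z \<le> p y})"
  proof (rule compactE_image[OF S(1) _ cover])
    show "open (- {y. p z \<le> p y})" for z
      using closed_superlevel_upper_semicont[OF p] by (rule open_Compl)
  qed
  have "D \<noteq> {}" using D(3) S(2) by auto
  then have "Max (p ` D) \<in> p ` D" using D(2) by (intro Max_in) auto
  then obtain m where m: "m \<in> D" "p m = Max (p ` D)" by auto
  have "p z \<le> p m" if "z \<in> D" for z using that D(2) unfolding m(2) by (intro Max_ge) auto
  moreover have "m \<in> (\<Union>z\<in>D. - {y. p z \<le> p y})" using D(1,3) m(1) by blast
  ultimately show False by force
qed

text \<open>
  Together with closedness this makes the positive superlevel sets of the functions below compact,
  the source of every existence statement about maximisers.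
\<close>

lemma bounded_superlevel_vanishing:
  fixes p :: "'a::real_normed_vector \<Rightarrow> real"
  assumes "(p \<longlongrightarrow> 0) at_infinity" "0 < c"
  shows "bounded {x. c \<le> p x}"
proof -
  have "\<forall>\<^sub>F x in at_infinity. p x < c" using assms by (simp add: order_tendsto_iff)
  then obtain b where "\<And>x. b \<le> norm x \<Longrightarrow> p x < c" unfolding eventually_at_infinity by auto
  then show ?thesis by (intro boundedI[of _ b]) (metis linear mem_Collect_eq not_le)
qed

section \<open>The class of normalised log-concave functions\<close>

lemma C0D:
  assumes "f \<in> C0"
  shows C0_nonneg: "0 \<le> f x" and C0_usc: "upper_semicont f"
    and C0_le_1: "f x \<le> 1" and C0_zero: "f 0 = 1" and C0_vanishing: "(f \<longlongrightarrow> 0) at_infinity"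
proof -
  show "0 \<le> f x" "upper_semicont f" "f 0 = 1" "(f \<longlongrightarrow> 0) at_infinity"
    using assms by (auto simp: C0_def)
  have "ereal \<bar>f x\<bar> \<le> sup_norm f" unfolding sup_norm_def by (rule SUP_upper) simp
  also have "\<dots> = 1" using assms by (auto simp: C0_def)
  finally show "f x \<le> 1" by simp
qed

lemma C0_log_concave:
  assumes "f \<in> C0" "0 \<le> l" "l \<le> 1" "0 < f x" "0 < f y"
  shows "f x powr l * f y powr (1 - l) \<le> f (l *\<^sub>R x + (1 - l) *\<^sub>R y)"
  using assms by (auto simp: C0_def log_concave_fun_def)

lemma C0I:
  assumes "\<And>x. 0 \<le> f x" "upper_semicont f" "log_concave_fun f" "\<And>x. f x \<le> 1" "f 0 = 1"
    "(f \<longlongrightarrow> 0) at_infinity"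
  shows "f \<in> C0"
proof -
  have "sup_norm f = ereal 1"
    unfolding sup_norm_def
  proof (rule antisym)
    show "(SUP x. ereal \<bar>f x\<bar>) \<le> ereal 1" using assms(1,4) by (intro SUP_least) simp
    show "ereal 1 \<le> (SUP x. ereal \<bar>f x\<bar>)" using assms(5) by (intro SUP_upper2[of 0]) auto
  qed
  then show ?thesis using assms by (simp add: C0_def)
qed

lemma C0_borel_measurable: "f \<in> C0 \<Longrightarrow> f \<in> borel_measurable borel"
  by (intro borel_measurable_upper_semicont C0_usc)

lemma C0_dilate:
  fixes f :: "'a::real_normed_vector \<Rightarrow> real"
  assumes f: "f \<in> C0" and c: "c \<noteq> 0"
  shows "(\<lambda>x. f (c *\<^sub>R x)) \<in> C0"
proof (rule C0I)
  show "upper_semicont (\<lambda>x. f (c *\<^sub>R x))"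
    by (intro upper_semicont_compose[OF C0_usc[OF f]] continuous_intros)
  show "log_concave_fun (\<lambda>x. f (c *\<^sub>R x))"
    unfolding log_concave_fun_def
  proof (intro allI ballI impI)
    fix x y and l :: real
    assume l: "l \<in> {0..1}" and pos: "0 < f (c *\<^sub>R x)" "0 < f (c *\<^sub>R y)"
    have "f (c *\<^sub>R x) powr l * f (c *\<^sub>R y) powr (1 - l)
        \<le> f (l *\<^sub>R c *\<^sub>R x + (1 - l) *\<^sub>R c *\<^sub>R y)"
      using l by (intro C0_log_concave[OF f _ _ pos]) auto
    also have "l *\<^sub>R c *\<^sub>R x + (1 - l) *\<^sub>R c *\<^sub>R y = c *\<^sub>R (l *\<^sub>R x + (1 - l) *\<^sub>R y)"
      by (simp add: scaleR_add_right mult.commute)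
    finally show "f (c *\<^sub>R x) powr l * f (c *\<^sub>R y) powr (1 - l)
        \<le> f (c *\<^sub>R (l *\<^sub>R x + (1 - l) *\<^sub>R y))" .
  qed
  have "filterlim (\<lambda>x::'a. c *\<^sub>R x) at_infinity at_infinity"
    unfolding filterlim_at_infinity[OF order_refl] eventually_at_infinity
  proof (intro allI impI)
    fix r :: real
    have "r \<le> norm (c *\<^sub>R x)" if "r / \<bar>c\<bar> \<le> norm x" for x :: 'a
      using that c by (simp add: field_simps)
    then show "\<exists>b. \<forall>x::'a. b \<le> norm x \<longrightarrow> r \<le> norm (c *\<^sub>R x)" by blast
  qed
  then show "((\<lambda>x. f (c *\<^sub>R x)) \<longlongrightarrow> 0) at_infinity"
    by (rule filterlim_compose[OF C0_vanishing[OF f]])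
qed (use C0D[OF f] in auto)

lemma C0_reflect: "f \<in> C0 \<Longrightarrow> reflect f \<in> C0"
  using C0_dilate[of f "-1"] by (simp add: reflect_def[abs_def])

text \<open>
  Values at most \<open>1\<close> only grow when raised to exponents at most \<open>1\<close>, so the exponents in the
  definition of log-concavity can be dropped.
\<close>

lemma C0_mult_le_convex_combination:
  assumes f: "f \<in> C0" and l: "0 \<le> l" "l \<le> 1"
  shows "f x * f y \<le> f (l *\<^sub>R x + (1 - l) *\<^sub>R y)"
proof (cases "f x = 0 \<or> f y = 0")
  case False
  then have pos: "0 < f x" "0 < f y" using C0_nonneg[OF f] by (auto simp: less_le)
  have "f x powr 1 * f y powr 1 \<le> f x powr l * f y powr (1 - l)"
    using pos l C0_le_1[OF f] by (intro mult_mono powr_mono') auto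
  also have "\<dots> \<le> f (l *\<^sub>R x + (1 - l) *\<^sub>R y)" by (rule C0_log_concave[OF f l pos])
  finally show ?thesis using pos by simp
qed (use C0_nonneg[OF f] in auto)

text \<open>
  Integrating the right-hand side over \<open>x + y\<close> instead of over the midpoint is where the factor
  \<open>2\<^sup>n\<close> of the theorem arises.
\<close>

lemma C0_mult_le_midpoint:
  assumes f: "f \<in> C0"
  shows "f x * f y \<le> (f ((1/2) *\<^sub>R (x + y)))\<^sup>2"
proof (cases "f x = 0 \<or> f y = 0")
  case False
  then have pos: "0 < f x" "0 < f y" using C0_nonneg[OF f] by (auto simp: less_le)
  have "sqrt (f x) * sqrt (f y) \<le> f ((1/2) *\<^sub>R (x + y))"
    using C0_log_concave[OF f _ _ pos, of "1/2"] pos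
    by (simp add: powr_half_sqrt scaleR_add_right)
  then have "(sqrt (f x) * sqrt (f y))\<^sup>2 \<le> (f ((1/2) *\<^sub>R (x + y)))\<^sup>2"
    using pos by (intro power_mono) auto
  then show ?thesis using pos by (simp add: power_mult_distrib)
qed auto

section \<open>The Asplund product\<close>

lemma asplund_alt: "(f \<star>\<^sub>0 g) x = (SUP y. f y * g (x - y))"
proof -
  have "(\<lambda>(y, z). f y * g z) ` {(y, z). y + z = x} = range (\<lambda>y. f y * g (x - y))"
    by (auto simp: image_iff) (metis add_diff_cancel_left')
  then show ?thesis by (simp add: asplund_def)
qed

lemma asplund_ge:
  assumes "f \<in> C0" "g \<in> C0"
  shows "f y * g z \<le> (f \<star>\<^sub>0 g) (y + z)"
proof -
  have "f y * g (y + z - y) \<le> (SUP u. f u * g (y + z - u))"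
  proof (rule cSUP_upper)
    show "bdd_above (range (\<lambda>u. f u * g (y + z - u)))"
      using C0D[OF assms(1)] C0D[OF assms(2)] by (intro bdd_aboveI2[of _ _ 1] mult_le_one) auto
  qed simp
  then show ?thesis by (simp add: asplund_alt)
qed

text \<open>
  For fixed \<open>x\<close> the function \<open>y \<mapsto> f y * g (x - y)\<close> is upper semicontinuous and dominated by \<open>f\<close>.
  If it is positive at \<open>u\<close>, then only the compact set where it is at least its value at \<open>u\<close> matters.
\<close>

lemma asplund_attained:
  fixes f g :: "'a::euclidean_space \<Rightarrow> real"
  assumes f: "f \<in> C0" and g: "g \<in> C0"
  obtains y where "(f \<star>\<^sub>0 g) x = f y * g (x - y)"
proof -
  let ?p = "\<lambda>y. f y * g (x - y)"
  have p: "upper_semicont ?p"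
    by (intro upper_semicont_mult upper_semicont_compose[OF C0_usc[OF g]] C0_usc[OF f]
          C0_nonneg[OF f] C0_nonneg[OF g] continuous_intros)
  have "\<exists>y. \<forall>z. ?p z \<le> ?p y"
  proof (cases "\<exists>u. ?p u > 0")
    case False
    moreover have "0 \<le> ?p z" for z using C0_nonneg[OF f] C0_nonneg[OF g] by simp
    ultimately have zero: "?p z = 0" for z by (metis order_le_less)
    have "?p z \<le> ?p x" for z using zero[of z] zero[of x] by linarith
    then show ?thesis by blast
  next
    case True
    then obtain u where u: "?p u > 0" by blast
    let ?S = "{y. ?p u \<le> ?p y}"
    have "?p y \<le> f y" for y
      using C0_nonneg[OF f] C0_le_1[OF g] by (intro mult_left_le)
    then have "?S \<subseteq> {y. ?p u \<le> f y}" using order_trans by blast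
    then have "bounded ?S"
      using bounded_subset bounded_superlevel_vanishing[OF C0_vanishing[OF f] u] by blast
    then have "compact ?S"
      using closed_superlevel_upper_semicont[OF p] by (simp add: compact_eq_bounded_closed)
    then obtain y where "y \<in> ?S" "\<forall>z\<in>?S. ?p z \<le> ?p y"
      using upper_semicont_attains_sup[OF p, of ?S] by auto
    then have "?p z \<le> ?p y" for z
      by (cases "?p u \<le> ?p z") auto
    then show ?thesis by blast
  qed
  then obtain y where y: "\<And>z. ?p z \<le> ?p y" by blast
  have "(f \<star>\<^sub>0 g) x \<le> ?p y" unfolding asplund_alt by (rule cSUP_least) (use y in auto)
  moreover have "?p y \<le> (f \<star>\<^sub>0 g) x" using asplund_ge[OF f g, of y "x - y"] by simp
  ultimately show ?thesis by (intro that antisym)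
qed

lemma asplund_ge_left: "f \<in> C0 \<Longrightarrow> g \<in> C0 \<Longrightarrow> f x \<le> (f \<star>\<^sub>0 g) x"
  using asplund_ge[of f g x 0] by (simp add: C0_zero)

lemma asplund_ge_right: "f \<in> C0 \<Longrightarrow> g \<in> C0 \<Longrightarrow> g x \<le> (f \<star>\<^sub>0 g) x"
  using asplund_ge[of f g 0 x] by (simp add: C0_zero)

text \<open>
  As suprema are attained, the superlevel set is the projection of a closed set of pairs \<open>(y, x)\<close>,
  and \<open>y\<close> may be confined to a compact superlevel set of \<open>f\<close>, because \<open>g\<close> is at most \<open>1\<close>.
\<close>

lemma closed_superlevel_asplund:
  fixes f g :: "'a::euclidean_space \<Rightarrow> real"
  assumes f: "f \<in> C0" and g: "g \<in> C0"
  shows "closed {x. c \<le> (f \<star>\<^sub>0 g) x}"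
proof (cases "c \<le> 0")
  case True
  have "0 \<le> (f \<star>\<^sub>0 g) x" for x
    using C0_nonneg[OF f, of x] asplund_ge_left[OF f g, of x] by linarith
  then have "c \<le> (f \<star>\<^sub>0 g) x" for x using order_trans[OF True] by blast
  then have "{x. c \<le> (f \<star>\<^sub>0 g) x} = UNIV" by blast
  then show ?thesis by simp
next
  case False
  let ?K = "{y. c \<le> f y}"
  let ?T = "{z :: 'a \<times> 'a. c \<le> f (fst z) * g (snd z - fst z)}"
  have K: "compact ?K"
    using closed_superlevel_upper_semicont[OF C0_usc[OF f]] False
      bounded_superlevel_vanishing[OF C0_vanishing[OF f], of c]
    by (simp add: compact_eq_bounded_closed)
  have "upper_semicont (\<lambda>z :: 'a \<times> 'a. f (fst z) * g (snd z - fst z))"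
    by (intro upper_semicont_mult upper_semicont_compose[OF C0_usc[OF f]]
          upper_semicont_compose[OF C0_usc[OF g]] C0_nonneg[OF f] C0_nonneg[OF g]
          continuous_intros)
  then have "closed ?T" by (rule closed_superlevel_upper_semicont)
  then have "closed {x. \<exists>y. y \<in> ?K \<and> (y, x) \<in> ?T}"
    by (rule closed_compact_projection[OF K])
  also have "{x. \<exists>y. y \<in> ?K \<and> (y, x) \<in> ?T} = {x. c \<le> (f \<star>\<^sub>0 g) x}"
  proof (intro equalityI subsetI; clarsimp)
    fix x y assume "c \<le> f y * g (x - y)"
    then show "c \<le> (f \<star>\<^sub>0 g) x" using asplund_ge[OF f g, of y "x - y"] by simp
  next
    fix x assume c: "c \<le> (f \<star>\<^sub>0 g) x"
    obtain y where y: "(f \<star>\<^sub>0 g) x = f y * g (x - y)" by (rule asplund_attained[OF f g])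
    have "f y * g (x - y) \<le> f y" using C0D[OF f] C0D[OF g] by (intro mult_left_le) auto
    then have "c \<le> f y \<and> c \<le> f y * g (x - y)" using c y by simp
    then show "\<exists>y. c \<le> f y \<and> c \<le> f y * g (x - y)" by blast
  qed
  finally show ?thesis .
qed

text \<open>
  Log-concavity follows by combining maximisers convexly. The product vanishes at infinity because
  one of two summands of a long vector is long.
\<close>

lemma C0_asplund:
  fixes f g :: "'a::euclidean_space \<Rightarrow> real"
  assumes f: "f \<in> C0" and g: "g \<in> C0"
  shows "f \<star>\<^sub>0 g \<in> C0"
proof (rule C0I)
  let ?F = "f \<star>\<^sub>0 g"
  note fD = C0D[OF f] and gD = C0D[OF g]
  show nonneg: "0 \<le> ?F x" for x
    using fD(1)[of x] asplund_ge_left[OF f g, of x] by linarith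
  show "upper_semicont ?F"
    by (rule upper_semicontI_closed_superlevel[OF closed_superlevel_asplund[OF f g]])
  show le1: "?F x \<le> 1" for x
    unfolding asplund_alt by (rule cSUP_least) (use fD gD in \<open>auto intro: mult_le_one\<close>)
  show "?F 0 = 1"
    using le1[of 0] asplund_ge_left[OF f g, of 0] fD(4) by simp
  show "log_concave_fun ?F"
    unfolding log_concave_fun_def
  proof (intro allI ballI impI)
    fix x x' :: 'a and l :: real
    assume l: "l \<in> {0..1}" and pos: "0 < ?F x" "0 < ?F x'"
    obtain y where y: "?F x = f y * g (x - y)" by (rule asplund_attained[OF f g])
    obtain y' where y': "?F x' = f y' * g (x' - y')" by (rule asplund_attained[OF f g])
    have p: "0 < f y" "0 < g (x - y)" "0 < f y'" "0 < g (x' - y')"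
      using pos fD(1)[of y] gD(1)[of "x - y"] fD(1)[of y'] gD(1)[of "x' - y'"]
      unfolding y y' by (auto simp: zero_less_mult_iff)
    let ?u = "l *\<^sub>R y + (1 - l) *\<^sub>R y'" and ?v = "l *\<^sub>R (x - y) + (1 - l) *\<^sub>R (x' - y')"
    have "?F x powr l * ?F x' powr (1 - l) =
        (f y powr l * f y' powr (1 - l)) * (g (x - y) powr l * g (x' - y') powr (1 - l))"
      unfolding y y' using p by (simp add: powr_mult mult_ac)
    also have "\<dots> \<le> f ?u * g ?v"
      using l p fD gD by (intro mult_mono C0_log_concave[OF f] C0_log_concave[OF g]) auto
    also have "\<dots> \<le> ?F (?u + ?v)" by (rule asplund_ge[OF f g])
    also have "?u + ?v = l *\<^sub>R x + (1 - l) *\<^sub>R x'" by (simp add: algebra_simps)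
    finally show "?F x powr l * ?F x' powr (1 - l) \<le> ?F (l *\<^sub>R x + (1 - l) *\<^sub>R x')" .
  qed
  show "(?F \<longlongrightarrow> 0) at_infinity"
  proof (rule order_tendstoI)
    fix a :: real assume "a < 0"
    then have "a < ?F x" for x using nonneg[of x] by linarith
    then show "\<forall>\<^sub>F x in at_infinity. a < ?F x" by simp
  next
    fix a :: real assume a: "0 < a"
    have "\<forall>\<^sub>F x in at_infinity. f x < a" "\<forall>\<^sub>F x in at_infinity. g x < a"
      using fD(5) gD(5) a by (auto simp: order_tendsto_iff)
    then obtain b c where b: "\<And>x. b \<le> norm x \<Longrightarrow> f x < a" and c: "\<And>x. c \<le> norm x \<Longrightarrow> g x < a"
      unfolding eventually_at_infinity by blast
    have "?F x < a" if x: "b + c \<le> norm x" for x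
    proof -
      obtain y where y: "?F x = f y * g (x - y)" by (rule asplund_attained[OF f g])
      have "norm x \<le> norm y + norm (x - y)" using norm_triangle_ineq[of y "x - y"] by simp
      then have "b \<le> norm y \<or> c \<le> norm (x - y)" using x by linarith
      then have "f y < a \<or> g (x - y) < a" using b c by blast
      moreover have "f y * g (x - y) \<le> f y" "f y * g (x - y) \<le> g (x - y)"
        using fD gD by (auto intro: mult_left_le mult_left_le_one_le)
      ultimately show ?thesis unfolding y by linarith
    qed
    then show "\<forall>\<^sub>F x in at_infinity. ?F x < a" unfolding eventually_at_infinity by blast
  qed
qed

section \<open>A Ruzsa triangle inequality\<close>

lemma L1_norm_C0: "f \<in> C0 \<Longrightarrow> L1_norm f = (\<integral>\<^sup>+ x. f x \<partial>lborel)"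
  by (simp add: L1_norm_def C0_nonneg)

lemma nn_integral_lborel_affine:
  fixes f :: "'a::euclidean_space \<Rightarrow> ennreal"
  assumes [measurable]: "f \<in> borel_measurable borel" and c: "c \<noteq> 0"
  shows "(\<integral>\<^sup>+ x. f x \<partial>lborel) = \<bar>c\<bar> ^ DIM('a) * (\<integral>\<^sup>+ x. f (t + c *\<^sub>R x) \<partial>lborel)"
  by (subst lborel_affine[OF c, of t])
     (simp add: nn_integral_density nn_integral_distr nn_integral_cmult ennreal_power)

lemma nn_integral_lborel_translate:
  fixes f :: "'a::euclidean_space \<Rightarrow> ennreal"
  assumes "f \<in> borel_measurable borel"
  shows "(\<integral>\<^sup>+ x. f (t + x) \<partial>lborel) = (\<integral>\<^sup>+ x. f x \<partial>lborel)"
  using nn_integral_lborel_affine[OF assms, of 1 t] by simp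

lemma L1_norm_C0_dilate:
  fixes f :: "'a::euclidean_space \<Rightarrow> real"
  assumes f: "f \<in> C0" and c: "0 < c"
  shows "(\<integral>\<^sup>+ x. f ((1 / c) *\<^sub>R x) \<partial>lborel) = ennreal (c ^ DIM('a)) * L1_norm f"
proof -
  have [measurable]: "f \<in> borel_measurable borel" by (rule C0_borel_measurable[OF f])
  show ?thesis
    using nn_integral_lborel_affine[of "\<lambda>x. ennreal (f ((1 / c) *\<^sub>R x))" c 0] c
    by (simp add: L1_norm_C0[OF f] ennreal_power)
qed

text \<open>
  If \<open>k\<close> attains \<open>(f \<star>\<^sub>0 g) x\<close>, then \<open>f k * p w\<close> is at most the product of \<open>f\<close> and \<open>p\<close> at \<open>k + w\<close>, and
  \<open>g (x - k) * p w\<close> is at most the product of \<open>g\<close> and the reflected \<open>p\<close> at \<open>x - (k + w)\<close>. Integrating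
  over \<open>w\<close> bounds \<open>(f \<star>\<^sub>0 g) x * \<integral> p\<^sup>2\<close> by the convolution at \<open>x\<close> of these two products, because
  the translation by \<open>k\<close> disappears under the integral. The integral of a convolution is the
  product of the integrals.
\<close>

lemma asplund_ruzsa_triangle:
  fixes f g p :: "'a::euclidean_space \<Rightarrow> real"
  assumes f: "f \<in> C0" and g: "g \<in> C0" and p: "p \<in> C0"
  shows "L1_norm (f \<star>\<^sub>0 g) * (\<integral>\<^sup>+ w. (p w)\<^sup>2 \<partial>lborel)
      \<le> L1_norm (f \<star>\<^sub>0 p) * L1_norm (g \<star>\<^sub>0 reflect p)"
proof -
  let ?F = "f \<star>\<^sub>0 g" and ?A = "f \<star>\<^sub>0 p" and ?B = "g \<star>\<^sub>0 reflect p"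
  note rp = C0_reflect[OF p]
  have C: "?F \<in> C0" "?A \<in> C0" "?B \<in> C0" using f g p rp C0_asplund by auto
  have [measurable]: "?F \<in> borel_measurable borel" "?A \<in> borel_measurable borel"
      "?B \<in> borel_measurable borel" "p \<in> borel_measurable borel"
    using C p C0_borel_measurable by auto
  have fibre: "ennreal (?F x) * (\<integral>\<^sup>+ w. (p w)\<^sup>2 \<partial>lborel)
      \<le> (\<integral>\<^sup>+ w. ennreal (?A w) * ennreal (?B (x - w)) \<partial>lborel)" for x
  proof -
    obtain k where k: "?F x = f k * g (x - k)" by (rule asplund_attained[OF f g])
    have "ennreal (?F x) * (\<integral>\<^sup>+ w. (p w)\<^sup>2 \<partial>lborel)
        = (\<integral>\<^sup>+ w. ennreal (?F x) * ennreal ((p w)\<^sup>2) \<partial>lborel)"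
      by (rule nn_integral_cmult[symmetric]) measurable
    also have "\<dots> \<le> (\<integral>\<^sup>+ w. ennreal (?A (k + w)) * ennreal (?B (x - (k + w))) \<partial>lborel)"
    proof (rule nn_integral_mono)
      fix w
      have "?F x * (p w)\<^sup>2 = (f k * p w) * (g (x - k) * reflect p (- w))"
        by (simp add: k reflect_def power2_eq_square)
      also have "\<dots> \<le> ?A (k + w) * ?B (x - k + (- w))"
        using C0_nonneg[OF f] C0_nonneg[OF g] C0_nonneg[OF p] C0_nonneg[OF rp] C0_nonneg[OF C(2)]
        by (intro mult_mono asplund_ge f g p rp mult_nonneg_nonneg) auto
      finally show "ennreal (?F x) * ennreal ((p w)\<^sup>2)
          \<le> ennreal (?A (k + w)) * ennreal (?B (x - (k + w)))"
        using C0_nonneg[OF C(1)] C0_nonneg[OF C(2)]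
        by (simp add: ennreal_mult'[symmetric] ennreal_leI diff_diff_eq)
    qed
    also have "\<dots> = (\<integral>\<^sup>+ w. ennreal (?A w) * ennreal (?B (x - w)) \<partial>lborel)"
      by (rule nn_integral_lborel_translate
          [where f="\<lambda>w. ennreal (?A w) * ennreal (?B (x - w))"]) measurable
    finally show ?thesis .
  qed
  have "L1_norm ?F * (\<integral>\<^sup>+ w. (p w)\<^sup>2 \<partial>lborel)
      = (\<integral>\<^sup>+ x. ennreal (?F x) * (\<integral>\<^sup>+ w. (p w)\<^sup>2 \<partial>lborel) \<partial>lborel)"
    unfolding L1_norm_C0[OF C(1)] by (rule nn_integral_multc[symmetric]) measurable
  also have "\<dots> \<le> (\<integral>\<^sup>+ x. (\<integral>\<^sup>+ w. ennreal (?A w) * ennreal (?B (x - w)) \<partial>lborel) \<partial>lborel)"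
    by (intro nn_integral_mono fibre)
  also have "\<dots> = (\<integral>\<^sup>+ w. (\<integral>\<^sup>+ x. ennreal (?A w) * ennreal (?B (x - w)) \<partial>lborel) \<partial>lborel)"
    by (rule lborel_pair.Fubini') measurable
  also have "\<dots> = (\<integral>\<^sup>+ w. ennreal (?A w) * L1_norm ?B \<partial>lborel)"
  proof (rule nn_integral_cong)
    fix w
    have "(\<integral>\<^sup>+ x. ennreal (?A w) * ennreal (?B (x - w)) \<partial>lborel)
        = ennreal (?A w) * (\<integral>\<^sup>+ x. ennreal (?B (- w + x)) \<partial>lborel)"
      by (subst nn_integral_cmult) auto
    also have "(\<integral>\<^sup>+ x. ennreal (?B (- w + x)) \<partial>lborel) = L1_norm ?B"
      unfolding L1_norm_C0[OF C(3)]
      by (rule nn_integral_lborel_translate[where f="\<lambda>x. ennreal (?B x)"]) measurable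
    finally show "(\<integral>\<^sup>+ x. ennreal (?A w) * ennreal (?B (x - w)) \<partial>lborel)
        = ennreal (?A w) * L1_norm ?B" .
  qed
  also have "\<dots> = L1_norm ?A * L1_norm ?B"
    unfolding L1_norm_C0[OF C(2)] by (rule nn_integral_multc) measurable
  finally show ?thesis .
qed

section \<open>The inequality\<close>

text \<open>
  The support of \<open>h = f \<star>\<^sub>0 reflect g\<close> is convex and contains \<open>0\<close>. If it is a null set, it spans a
  proper subspace. This subspace contains the supports of \<open>f\<close> and of the reflection of \<open>g\<close>, which
  lie below \<open>h\<close>, and hence also the support of \<open>f \<star>\<^sub>0 g\<close>.
\<close>

lemma L1_norm_asplund_null:
  fixes f g :: "'a::euclidean_space \<Rightarrow> real"
  assumes f: "f \<in> C0" and g: "g \<in> C0" and null: "L1_norm (f \<star>\<^sub>0 reflect g) = 0"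
  shows "L1_norm (f \<star>\<^sub>0 g) = 0"
proof -
  let ?h = "f \<star>\<^sub>0 reflect g" and ?F = "f \<star>\<^sub>0 g"
  note rg = C0_reflect[OF g]
  have h: "?h \<in> C0" and F: "?F \<in> C0" using f g rg C0_asplund by auto
  have [measurable]: "?h \<in> borel_measurable borel" by (rule C0_borel_measurable[OF h])
  let ?S = "{x. 0 < ?h x}"
  have "AE x in lborel. ?h x = 0"
    using null C0_nonneg[OF h] by (simp add: L1_norm_C0[OF h] nn_integral_0_iff_AE antisym)
  then have "AE x in lborel. x \<notin> ?S" by eventually_elim simp
  then have "?S \<in> null_sets lborel" by (simp add: AE_iff_null_sets)
  then have "negligible ?S"
    using null_sets_completionI negligible_iff_null_sets by blast
  moreover have "convex ?S"
    unfolding convex_alt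
  proof (intro ballI allI impI)
    fix x y and u :: real assume xy: "x \<in> ?S" "y \<in> ?S" and u: "0 \<le> u \<and> u \<le> 1"
    have "0 < ?h y * ?h x" using xy by simp
    also have "\<dots> \<le> ?h (u *\<^sub>R y + (1 - u) *\<^sub>R x)"
      using C0_mult_le_convex_combination[OF h, of u y x] u by simp
    finally show "(1 - u) *\<^sub>R x + u *\<^sub>R y \<in> ?S" by (simp add: add.commute)
  qed
  ultimately have "interior ?S = {}" "convex ?S" by (simp_all add: negligible_convex_interior)
  moreover have "0 \<in> ?S" using C0_zero[OF h] by simp
  ultimately have "affine hull ?S \<noteq> UNIV"
    using rel_interior_interior[of ?S] rel_interior_eq_empty[of ?S] by auto
  then have "span ?S \<noteq> UNIV"
    using affine_hull_span_0[of ?S] \<open>0 \<in> ?S\<close> hull_inc[of 0 ?S affine] by simp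
  then have "dim ?S < DIM('a)"
    using dim_eq_full[of ?S] dim_subset_UNIV[of ?S] by (simp add: less_le)
  then have "negligible (span ?S)" by (intro negligible_lowdim) simp
  moreover have "{x. ?F x \<noteq> 0} \<subseteq> span ?S"
  proof
    fix x assume x: "x \<in> {x. ?F x \<noteq> 0}"
    obtain k where k: "?F x = f k * g (x - k)" by (rule asplund_attained[OF f g])
    have "0 < f k" "0 < reflect g (k - x)"
      using x k C0_nonneg[OF f] C0_nonneg[OF g] by (auto simp: less_le reflect_def)
    then have "k \<in> ?S" "k - x \<in> ?S"
      using asplund_ge_left[OF f rg, of k] asplund_ge_right[OF f rg, of "k - x"] by auto
    then have "k - (k - x) \<in> span ?S" by (intro span_diff span_base)
    then show "x \<in> span ?S" by simp
  qed
  ultimately have "negligible {x. ?F x \<noteq> 0}" by (rule negligible_subset)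
  moreover have [measurable]: "?F \<in> borel_measurable borel" by (rule C0_borel_measurable[OF F])
  have "{x. ?F x \<noteq> 0} \<in> sets lborel" by simp
  ultimately have "{x. ?F x \<noteq> 0} \<in> null_sets lborel"
    using negligible_iff_null_sets null_sets_completion_iff by blast
  from AE_not_in[OF this] have "AE x in lborel. ennreal (?F x) = 0" by eventually_elim simp
  then show ?thesis by (simp add: L1_norm_C0[OF F] nn_integral_0_iff_AE)
qed

text \<open>
  The triangle inequality is applied with \<open>\<phi> = reflect g \<star>\<^sub>0 \<psi>\<close>, where \<open>\<psi> z = h (z / e)\<close>. Since \<open>f \<star>\<^sub>0 \<phi>\<close>
  is the product of \<open>h\<close> with \<open>\<psi>\<close>, it lies below a dilate of \<open>h\<close>: a body plus \<open>e\<close> times itself is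
  its dilate by \<open>1 + e\<close>. The weight \<open>\<integral> \<phi>\<^sup>2\<close> can be cancelled, being nonzero as \<open>\<phi>\<close> dominates \<open>\<psi>\<close>,
  and finite as \<open>\<phi>\<^sup>2 \<le> \<phi> \<le> f \<star>\<^sub>0 \<phi>\<close>.
\<close>

lemma L1_norm_asplund_reflect_le_dilated:
  fixes f g :: "'a::euclidean_space \<Rightarrow> real"
  assumes f: "f \<in> C0" and g: "g \<in> C0" and e: "0 < e"
    and pos: "L1_norm (f \<star>\<^sub>0 reflect g) \<noteq> 0" and fin: "L1_norm (f \<star>\<^sub>0 reflect g) \<noteq> \<infinity>"
  shows "L1_norm (f \<star>\<^sub>0 g)
      \<le> ennreal ((1 + e) ^ DIM('a)) * L1_norm (f \<star>\<^sub>0 reflect g) * ennreal (2 ^ DIM('a))"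
proof -
  define h where "h = f \<star>\<^sub>0 reflect g"
  define \<psi> where "\<psi> = (\<lambda>z. h ((1 / e) *\<^sub>R z))"
  define \<phi> where "\<phi> = reflect g \<star>\<^sub>0 \<psi>"
  note rg = C0_reflect[OF g]
  have h: "h \<in> C0" unfolding h_def by (rule C0_asplund[OF f rg])
  have \<psi>: "\<psi> \<in> C0" unfolding \<psi>_def using e by (intro C0_dilate[OF h]) auto
  have \<phi>: "\<phi> \<in> C0" unfolding \<phi>_def by (rule C0_asplund[OF rg \<psi>])
  note r\<phi> = C0_reflect[OF \<phi>]
  have A: "f \<star>\<^sub>0 \<phi> \<in> C0" and B: "g \<star>\<^sub>0 reflect \<phi> \<in> C0" using C0_asplund f g \<phi> r\<phi> by auto
  have [measurable]: "\<phi> \<in> borel_measurable borel" "\<psi> \<in> borel_measurable borel"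
    using C0_borel_measurable \<phi> \<psi> by auto
  let ?C = "\<integral>\<^sup>+ w. (\<phi> w)\<^sup>2 \<partial>lborel"
  have "L1_norm (f \<star>\<^sub>0 \<phi>) \<le> (\<integral>\<^sup>+ x. h ((1 / (1 + e)) *\<^sub>R x) \<partial>lborel)"
    unfolding L1_norm_C0[OF A]
  proof (intro nn_integral_mono ennreal_leI)
    fix x
    obtain y where y: "(f \<star>\<^sub>0 \<phi>) x = f y * \<phi> (x - y)" by (rule asplund_attained[OF f \<phi>])
    obtain z where z: "\<phi> (x - y) = reflect g z * \<psi> (x - y - z)"
      unfolding \<phi>_def by (rule asplund_attained[OF rg \<psi>])
    \<comment> \<open>This weight recombines \<open>y + z\<close> and \<open>(x - y - z) / e\<close> to a multiple of \<open>x\<close>.\<close>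
    define l where "l = 1 / (1 + e)"
    have "0 < 1 + e" using e by simp
    then have l: "0 \<le> l" "l \<le> 1" "1 - l = e * l" using e by (auto simp: l_def divide_simps)
    have "(f \<star>\<^sub>0 \<phi>) x = (f y * reflect g z) * \<psi> (x - y - z)" by (simp add: y z)
    also have "\<dots> \<le> h (y + z) * \<psi> (x - y - z)"
      unfolding h_def by (intro mult_right_mono asplund_ge[OF f rg] C0_nonneg[OF \<psi>])
    also have "\<dots> \<le> h (l *\<^sub>R (y + z) + (1 - l) *\<^sub>R ((1 / e) *\<^sub>R (x - y - z)))"
      unfolding \<psi>_def by (rule C0_mult_le_convex_combination[OF h l(1,2)])
    also have "l *\<^sub>R (y + z) + (1 - l) *\<^sub>R ((1 / e) *\<^sub>R (x - y - z)) = l *\<^sub>R x"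
    proof -
      have "(1 - l) *\<^sub>R ((1 / e) *\<^sub>R (x - y - z)) = l *\<^sub>R (x - y - z)"
        using e unfolding l(3) by simp
      then show ?thesis by (simp add: algebra_simps)
    qed
    finally show "(f \<star>\<^sub>0 \<phi>) x \<le> h ((1 / (1 + e)) *\<^sub>R x)" by (simp add: l_def)
  qed
  also have "\<dots> = ennreal ((1 + e) ^ DIM('a)) * L1_norm h"
    using e by (intro L1_norm_C0_dilate[OF h]) auto
  finally have 1: "L1_norm (f \<star>\<^sub>0 \<phi>) \<le> ennreal ((1 + e) ^ DIM('a)) * L1_norm h" .
  have "L1_norm (g \<star>\<^sub>0 reflect \<phi>) \<le> (\<integral>\<^sup>+ x. ennreal ((\<phi> ((- 1 / 2) *\<^sub>R x))\<^sup>2) \<partial>lborel)"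
    unfolding L1_norm_C0[OF B]
  proof (intro nn_integral_mono ennreal_leI)
    fix x
    obtain y where y: "(g \<star>\<^sub>0 reflect \<phi>) x = g y * reflect \<phi> (x - y)"
      by (rule asplund_attained[OF g r\<phi>])
    have "(g \<star>\<^sub>0 reflect \<phi>) x = reflect g (- y) * \<phi> (y - x)" by (simp add: y reflect_def)
    also have "\<dots> \<le> \<phi> (- y) * \<phi> (y - x)"
      using asplund_ge_left[OF rg \<psi>, of "- y"]
      by (intro mult_right_mono C0_nonneg[OF \<phi>]) (simp add: \<phi>_def)
    also have "\<dots> \<le> (\<phi> ((1/2) *\<^sub>R (- y + (y - x))))\<^sup>2" by (rule C0_mult_le_midpoint[OF \<phi>])
    finally show "(g \<star>\<^sub>0 reflect \<phi>) x \<le> (\<phi> ((- 1 / 2) *\<^sub>R x))\<^sup>2" by simp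
  qed
  also have "\<dots> = ennreal (2 ^ DIM('a)) * ?C"
    using nn_integral_lborel_affine[of "\<lambda>x. ennreal ((\<phi> ((- 1 / 2) *\<^sub>R x))\<^sup>2)" "- 2" 0]
    by (simp add: ennreal_power[symmetric])
  finally have 2: "L1_norm (g \<star>\<^sub>0 reflect \<phi>) \<le> ennreal (2 ^ DIM('a)) * ?C" .
  have "?C \<le> L1_norm (f \<star>\<^sub>0 \<phi>)"
    unfolding L1_norm_C0[OF A]
  proof (intro nn_integral_mono ennreal_leI)
    fix x
    have "(\<phi> x)\<^sup>2 \<le> \<phi> x"
      using C0_nonneg[OF \<phi>] C0_le_1[OF \<phi>] by (simp add: power2_eq_square mult_left_le)
    also have "\<dots> \<le> (f \<star>\<^sub>0 \<phi>) x" by (rule asplund_ge_right[OF f \<phi>])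
    finally show "(\<phi> x)\<^sup>2 \<le> (f \<star>\<^sub>0 \<phi>) x" .
  qed
  also note 1
  also have "L1_norm h < top" using fin by (simp add: h_def less_top[symmetric])
  then have "ennreal ((1 + e) ^ DIM('a)) * L1_norm h < top" by (simp add: ennreal_mult_less_top)
  finally have C_fin: "?C < top" .
  have C_pos: "?C \<noteq> 0"
  proof
    assume "?C = 0"
    then have "AE x in lborel. ennreal ((\<phi> x)\<^sup>2) = 0"
      by (subst (asm) nn_integral_0_iff_AE) measurable
    then have "AE x in lborel. ennreal (\<psi> x) = 0"
    proof eventually_elim
      case (elim x)
      have "\<psi> x \<le> \<phi> x" unfolding \<phi>_def by (rule asplund_ge_right[OF rg \<psi>])
      with elim show ?case by (simp add: ennreal_neg)
    qed
    then have "(\<integral>\<^sup>+ x. \<psi> x \<partial>lborel) = 0" by (subst nn_integral_0_iff_AE) measurable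
    then show False
      using L1_norm_C0_dilate[OF h e] e pos by (simp add: \<psi>_def h_def)
  qed
  have "L1_norm (f \<star>\<^sub>0 g) * ?C \<le> L1_norm (f \<star>\<^sub>0 \<phi>) * L1_norm (g \<star>\<^sub>0 reflect \<phi>)"
    by (rule asplund_ruzsa_triangle[OF f g \<phi>])
  also have "\<dots> \<le> (ennreal ((1 + e) ^ DIM('a)) * L1_norm h) * (ennreal (2 ^ DIM('a)) * ?C)"
    by (intro mult_mono 1 2) auto
  finally have "?C * L1_norm (f \<star>\<^sub>0 g)
      \<le> ?C * (ennreal ((1 + e) ^ DIM('a)) * L1_norm h * ennreal (2 ^ DIM('a)))"
    by (simp add: mult_ac)
  then show ?thesis
    using C_fin C_pos unfolding h_def[symmetric]
    by (subst (asm) ennreal_mult_le_mult_iff) auto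
qed

lemma L1_norm_asplund_le_reflect:
  fixes f g :: "'a::euclidean_space \<Rightarrow> real"
  assumes f: "f \<in> C0" and g: "g \<in> C0"
  shows "L1_norm (f \<star>\<^sub>0 g) \<le> 2 ^ DIM('a) * L1_norm (f \<star>\<^sub>0 reflect g)"
proof -
  let ?H = "L1_norm (f \<star>\<^sub>0 reflect g)"
  consider "?H = 0" | "?H = \<infinity>" | "?H \<noteq> 0" "?H \<noteq> \<infinity>" by blast
  then show ?thesis
  proof cases
    case 1
    then show ?thesis using L1_norm_asplund_null[OF f g] by simp
  next
    case 2
    then show ?thesis by (simp add: ennreal_mult_top)
  next
    case 3
    then obtain r where r: "0 \<le> r" "?H = ennreal r" by (cases ?H) auto
    let ?b = "\<lambda>e. (1 + e) ^ DIM('a) * r * 2 ^ DIM('a)"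
    have "(?b \<longlongrightarrow> (1 + 0) ^ DIM('a) * r * 2 ^ DIM('a)) (at_right 0)"
      by (intro tendsto_intros)
    then have "((\<lambda>e. ennreal (?b e)) \<longlongrightarrow> ennreal ((1 + 0) ^ DIM('a) * r * 2 ^ DIM('a))) (at_right 0)"
      by (rule tendsto_ennrealI)
    moreover have "\<forall>\<^sub>F e in at_right 0. L1_norm (f \<star>\<^sub>0 g) \<le> ennreal (?b e)"
      using eventually_at_right_less[of "0::real"]
    proof eventually_elim
      case (elim e)
      then show ?case
        using L1_norm_asplund_reflect_le_dilated[OF f g elim 3] r by (simp add: ennreal_mult')
    qed
    ultimately have "L1_norm (f \<star>\<^sub>0 g) \<le> ennreal ((1 + 0) ^ DIM('a) * r * 2 ^ DIM('a))"
      by (intro tendsto_lowerbound) auto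
    then show ?thesis using r by (simp add: ennreal_mult' ennreal_power[symmetric] mult.commute)
  qed
qed

section \<open>Sharpness\<close>

definition orthant_exp :: "'a::euclidean_space \<Rightarrow> real" where
  "orthant_exp x = (if \<forall>b\<in>Basis. 0 \<le> x \<bullet> b then exp (- (\<Sum>b\<in>Basis. x \<bullet> b)) else 0)"

lemma orthant_exp_C0: "(orthant_exp :: 'a::euclidean_space \<Rightarrow> real) \<in> C0"
proof (rule C0I)
  let ?f = "orthant_exp :: 'a \<Rightarrow> real" and ?O = "{x::'a. \<forall>b\<in>Basis. 0 \<le> x \<bullet> b}"
  show nonneg: "0 \<le> ?f x" for x by (simp add: orthant_exp_def)
  show le1: "?f x \<le> 1" for x by (simp add: orthant_exp_def sum_nonneg)
  show "?f 0 = 1" by (simp add: orthant_exp_def)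
  show "upper_semicont ?f"
  proof (rule upper_semicontI_closed_superlevel)
    fix c :: real
    have "closed {x::'a. c \<le> exp (- (\<Sum>b\<in>Basis. x \<bullet> b))}"
      by (intro closed_Collect_le continuous_intros)
    moreover have "closed ?O" by (unfold Ball_def, intro closed_Collect_all closed_Collect_imp closed_Collect_le
          continuous_intros open_Collect_const)
    ultimately have "closed (?O \<inter> {x::'a. c \<le> exp (- (\<Sum>b\<in>Basis. x \<bullet> b))})" by blast
    moreover have "{x. c \<le> ?f x} =
        (if c \<le> 0 then UNIV else ?O \<inter> {x::'a. c \<le> exp (- (\<Sum>b\<in>Basis. x \<bullet> b))})"
      using order_trans[OF _ nonneg] by (auto simp: orthant_exp_def split: if_splits)
    ultimately show "closed {x. c \<le> ?f x}" by simp
  qed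
  show "log_concave_fun ?f"
    unfolding log_concave_fun_def
  proof (intro allI ballI impI)
    fix x y :: 'a and l :: real assume l: "l \<in> {0..1}" and "0 < ?f x" "0 < ?f y"
    then have O: "x \<in> ?O" "y \<in> ?O" by (auto simp: orthant_exp_def split: if_splits)
    then have "l *\<^sub>R x + (1 - l) *\<^sub>R y \<in> ?O" using l by (auto simp: inner_add_left)
    then show "?f x powr l * ?f y powr (1 - l) \<le> ?f (l *\<^sub>R x + (1 - l) *\<^sub>R y)"
      using O by (simp add: orthant_exp_def powr_def inner_add_left sum.distrib
          sum_distrib_left[symmetric] exp_add[symmetric])
  qed
  have "?f x \<le> exp (- norm x)" for x
  proof -
    have "norm x \<le> (\<Sum>b\<in>Basis. \<bar>x \<bullet> b\<bar>)" by (rule norm_le_l1)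
    then show ?thesis by (auto simp: orthant_exp_def)
  qed
  moreover have "((\<lambda>x::'a. exp (- norm x)) \<longlongrightarrow> 0) at_infinity"
    by (rule filterlim_compose[OF exp_at_bot])
       (simp add: filterlim_uminus_at_bot filterlim_norm_at_top)
  ultimately show "(?f \<longlongrightarrow> 0) at_infinity"
    using nonneg by (intro tendsto_sandwich[of "\<lambda>_. 0" ?f _ "\<lambda>x. exp (- norm x)"]) auto
qed

lemma nn_integral_exp_half_line:
  "(\<integral>\<^sup>+ t. ennreal (if 0 \<le> t then exp (- t) else 0) \<partial>lborel) = 1"
proof -
  have "((\<lambda>t::real. - exp (- t)) \<longlongrightarrow> - 0) at_top"
    by (intro tendsto_intros filterlim_compose[OF exp_at_bot] filterlim_uminus_at_bot_at_top)
  then have "(\<integral>\<^sup>+ t. ennreal (exp (- t)) * indicator {0..} t \<partial>lborel)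
      = ennreal (- 0 - (- exp (- 0)))"
    by (intro nn_integral_FTC_atLeast) (auto intro!: derivative_eq_intros)
  moreover have "ennreal (if 0 \<le> t then exp (- t) else 0) = ennreal (exp (- t)) * indicator {0..} t"
    for t :: real by (simp add: indicator_def)
  ultimately show ?thesis by simp
qed

lemma nn_integral_exp_abs: "(\<integral>\<^sup>+ t. ennreal (exp (- \<bar>t::real\<bar>)) \<partial>lborel) = 2"
proof -
  let ?e = "\<lambda>t::real. ennreal (if 0 \<le> t then exp (- t) else 0)"
  have "(\<integral>\<^sup>+ t. ?e t \<partial>lborel) = (\<integral>\<^sup>+ t. ?e (0 + - 1 *\<^sub>R t) \<partial>lborel)"
    using nn_integral_lborel_affine[of ?e "- 1" 0] by (simp)
  then have "(\<integral>\<^sup>+ t. ?e (- t) \<partial>lborel) = 1"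
    using nn_integral_exp_half_line by (simp only: add_0_left scaleR_minus1_left)
  then have "(\<integral>\<^sup>+ t. ?e t + ?e (- t) \<partial>lborel) = 2"
    using nn_integral_exp_half_line by (subst nn_integral_add) auto
  moreover have "(\<integral>\<^sup>+ t. ?e t + ?e (- t) \<partial>lborel) = (\<integral>\<^sup>+ t. ennreal (exp (- \<bar>t::real\<bar>)) \<partial>lborel)"
  proof (rule nn_integral_cong_AE)
    have "AE t in lborel. t \<noteq> (0::real)" by (rule AE_lborel_singleton)
    then show "AE t in lborel. ?e t + ?e (- t) = ennreal (exp (- \<bar>t\<bar>))"
      by eventually_elim auto
  qed
  ultimately show ?thesis by simp
qed

text \<open>
  A sum of two points of the orthant lies in the orthant, and the exponential is multiplicative on
  it, so \<open>orthant_exp \<star>\<^sub>0 orthant_exp\<close> is at most \<open>orthant_exp\<close>, a product of one-dimensional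
  densities of total mass \<open>1\<close>.
\<close>

lemma L1_norm_orthant_exp_self:
  "L1_norm ((orthant_exp :: 'a::euclidean_space \<Rightarrow> real) \<star>\<^sub>0 orthant_exp) \<le> 1"
proof -
  let ?f = "orthant_exp :: 'a \<Rightarrow> real"
  note C = C0_asplund[OF orthant_exp_C0 orthant_exp_C0, where 'a='a]
  have "L1_norm (?f \<star>\<^sub>0 ?f) \<le>
      (\<integral>\<^sup>+ x. (\<Prod>b\<in>Basis. ennreal (if 0 \<le> (x::'a) \<bullet> b then exp (- (x \<bullet> b)) else 0)) \<partial>lborel)"
    unfolding L1_norm_C0[OF C]
  proof (rule nn_integral_mono)
    fix x :: 'a
    obtain y where y: "(?f \<star>\<^sub>0 ?f) x = ?f y * ?f (x - y)"
      by (rule asplund_attained[OF orthant_exp_C0 orthant_exp_C0])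
    have "?f y * ?f (x - y) \<le> ?f x"
    proof (cases "(\<forall>b\<in>Basis. 0 \<le> y \<bullet> b) \<and> (\<forall>b\<in>Basis. 0 \<le> (x - y) \<bullet> b)")
      case True
      then have "\<forall>b\<in>Basis. 0 \<le> x \<bullet> b" by (force simp: inner_diff_left)
      then show ?thesis using True
        by (simp add: orthant_exp_def exp_add[symmetric] inner_diff_left sum_subtractf)
    qed (auto simp: orthant_exp_def)
    also have "?f x = (\<Prod>b\<in>Basis. if 0 \<le> x \<bullet> b then exp (- (x \<bullet> b)) else 0)"
      by (auto simp: orthant_exp_def exp_sum sum_negf[symmetric])
    finally show "ennreal ((?f \<star>\<^sub>0 ?f) x)
        \<le> (\<Prod>b\<in>Basis. ennreal (if 0 \<le> x \<bullet> b then exp (- (x \<bullet> b)) else 0))"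
      unfolding y by (subst prod_ennreal) (auto intro: ennreal_leI)
  qed
  also have "\<dots> = 1"
    by (subst nn_integral_lborel_prod) (auto simp: nn_integral_exp_half_line)
  finally show ?thesis .
qed

text \<open>
  Splitting \<open>x\<close> into its positive and negative parts shows that the product is at least
  \<open>exp (- (|x\<^sub>1| + \<dots> + |x\<^sub>n|))\<close>.
\<close>

lemma L1_norm_orthant_exp_reflect:
  "2 ^ DIM('a) \<le> L1_norm ((orthant_exp :: 'a::euclidean_space \<Rightarrow> real) \<star>\<^sub>0 reflect orthant_exp)"
proof -
  let ?f = "orthant_exp :: 'a \<Rightarrow> real"
  note f = orthant_exp_C0[where 'a='a]
  note C = C0_asplund[OF f C0_reflect[OF f]]
  have "(2::ennreal) ^ DIM('a) = (\<integral>\<^sup>+ x. (\<Prod>b\<in>Basis. ennreal (exp (- \<bar>(x::'a) \<bullet> b\<bar>))) \<partial>lborel)"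
    by (subst nn_integral_lborel_prod) (auto simp: nn_integral_exp_abs)
  also have "\<dots> \<le> L1_norm (?f \<star>\<^sub>0 reflect ?f)"
    unfolding L1_norm_C0[OF C]
  proof (rule nn_integral_mono)
    fix x :: 'a
    define y z :: 'a where "y = (\<Sum>b\<in>Basis. max (x \<bullet> b) 0 *\<^sub>R b)"
      and "z = (\<Sum>b\<in>Basis. max (- (x \<bullet> b)) 0 *\<^sub>R b)"
    have yb: "y \<bullet> b = max (x \<bullet> b) 0" and zb: "z \<bullet> b = max (- (x \<bullet> b)) 0" if "b \<in> Basis" for b
      using that by (simp_all add: y_def z_def)
    have x: "y + - z = x"
      by (rule euclidean_eqI) (auto simp: inner_diff_left yb zb max_def)
    have "(\<Prod>b\<in>Basis. exp (- \<bar>x \<bullet> b\<bar>)) = exp (- (\<Sum>b\<in>Basis. y \<bullet> b)) * exp (- (\<Sum>b\<in>Basis. z \<bullet> b))"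
      by (auto simp: exp_sum[symmetric] exp_add[symmetric] sum_negf[symmetric]
          sum.distrib[symmetric] sum_subtractf[symmetric] yb zb max_def intro!: sum.cong)
    also have "\<dots> = ?f y * reflect ?f (- z)"
      by (simp add: orthant_exp_def reflect_def yb zb)
    also have "\<dots> \<le> (?f \<star>\<^sub>0 reflect ?f) (y + - z)" by (rule asplund_ge[OF f C0_reflect[OF f]])
    finally show "(\<Prod>b\<in>Basis. ennreal (exp (- \<bar>x \<bullet> b\<bar>))) \<le> ennreal ((?f \<star>\<^sub>0 reflect ?f) x)"
      unfolding x by (subst prod_ennreal) (auto intro: ennreal_leI)
  qed
  finally show ?thesis .
qed

theorem proposition1p6:
  shows "(\<forall>f\<in>(C0 :: (real ^ 'n \<Rightarrow> real) set). \<forall>g\<in>C0.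
            L1_norm (f \<star>\<^sub>0 g) \<le> 2 ^ CARD('n) * L1_norm (f \<star>\<^sub>0 reflect g))
       \<and> (\<forall>c::ennreal. c < 2 ^ CARD('n) \<longrightarrow>
            \<not> (\<forall>f\<in>(C0 :: (real ^ 'n \<Rightarrow> real) set). \<forall>g\<in>C0.
                 L1_norm (f \<star>\<^sub>0 g) \<le> c * L1_norm (f \<star>\<^sub>0 reflect g)))"
proof (intro conjI ballI allI impI notI)
  fix f g :: "real ^ 'n \<Rightarrow> real"
  assume "f \<in> C0" "g \<in> C0"
  then show "L1_norm (f \<star>\<^sub>0 g) \<le> 2 ^ CARD('n) * L1_norm (f \<star>\<^sub>0 reflect g)"
    using L1_norm_asplund_le_reflect[of f g] by simp
next
  fix c :: ennreal
  let ?f = "orthant_exp :: real ^ 'n \<Rightarrow> real"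
  assume c: "c < 2 ^ CARD('n)"
    and le: "\<forall>f\<in>(C0 :: (real ^ 'n \<Rightarrow> real) set). \<forall>g\<in>C0.
               L1_norm (f \<star>\<^sub>0 g) \<le> c * L1_norm (f \<star>\<^sub>0 reflect g)"
  have "2 ^ CARD('n) \<le> L1_norm (?f \<star>\<^sub>0 reflect ?f)"
    using L1_norm_orthant_exp_reflect[where 'a="real ^ 'n"] by simp
  also have "\<dots> \<le> c * L1_norm (?f \<star>\<^sub>0 reflect (reflect ?f))"
    using le orthant_exp_C0 C0_reflect by blast
  also have "reflect (reflect ?f) = ?f" by (simp add: reflect_def fun_eq_iff)
  also have "c * L1_norm (?f \<star>\<^sub>0 ?f) \<le> c * 1"
    by (intro mult_left_mono L1_norm_orthant_exp_self) simp
  finally show False using c by simp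
qed

end
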